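(* Let $d\ge 4$. Then there is a set $P=\{p_0,\dots,p_{d+2}\}$ of $d+3$ points in $\mathbb{R}^d$ in general position such that each pair of distinct points in $P$ defines a unique distance and the order $<$ that $P$ induces on $\binom{[d+3]}{2}$ satisfies the following conditions: (1) for any $(i,j)\in\binom{[d]}{2}$ and $(k,l)\in\binom{[d+3]}{2}\setminus\binom{[d]}{2}$ we have $(k,l)<(i,j)$, and (2) for any $(i,j)\in[d]\times\{d,d+1,d+2\}$ and $(k,l)\in\binom{[d+3]}{2}\setminus\left([d]\times\{d,d+1,d+2\}\right)$ we have $(i,j)<(k,l)$.
   Context: For a positive integer $n$, $[n]=\{0,1,\dots,n-1\}$, and $\binom{[n]}{2}$ denotes the set of ordered pairs $(i,j)\in[n]\times[n]$ with $i<j$. A set of points in $\mathbb{R}^d$ is in general position if no $d+1$ of its elements lie on the same hyperplane. "Each pair of distinct points defines a unique distance" means that the distances $\|p_i-p_j\|$ (Euclidean norm), $(i,j)\in\binom{[d+3]}{2}$, are pairwise distinct. The order induced by $P=\{p_0,\dots,p_{n-1}\}$ on $\binom{[n]}{2}$ is given by $(i,j)<(k,l)\iff\|p_i-p_j\|<\|p_k-p_l\|$. *)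

theory Defs
  imports "HOL-Analysis.Analysis"
begin

definition hyperplane :: "('a::euclidean_space) set \<Rightarrow> bool" where
  "hyperplane H \<longleftrightarrow> (\<exists>a b. a \<noteq> 0 \<and> H = {x. a \<bullet> x = b})"

definition general_position :: "('a::euclidean_space) set \<Rightarrow> bool" where
  "general_position P \<longleftrightarrow>
     (\<forall>S. S \<subseteq> P \<and> finite S \<and> card S = DIM('a) + 1 \<longrightarrow> \<not> (\<exists>H. hyperplane H \<and> S \<subseteq> H))"

definition index_pairs :: "nat \<Rightarrow> (nat \<times> nat) set" where
  "index_pairs n = {(i, j). i \<in> {0..<n} \<and> j \<in> {0..<n} \<and> i < j}"

definition distinct_distances :: "nat \<Rightarrow> (nat \<Rightarrow> 'a::metric_space) \<Rightarrow> bool" where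
  "distinct_distances n p \<longleftrightarrow> inj_on (\<lambda>(i, j). dist (p i) (p j)) (index_pairs n)"

definition distance_order ::
    "nat \<Rightarrow> (nat \<Rightarrow> 'a::metric_space) \<Rightarrow> ((nat \<times> nat) \<times> (nat \<times> nat)) set" where
  "distance_order n p =
     {((i, j), (k, l)). (i, j) \<in> index_pairs n \<and> (k, l) \<in> index_pairs n \<and>
                        dist (p i) (p j) < dist (p k) (p l)}"

end

theory Submission
  imports Defs
begin

text \<open>
  The conditions that compare distances are strict, hence survive small perturbations of the points,
  while general position and distinctness of the distances hold after a suitable arbitrarily small
  perturbation. So it suffices to find a configuration, possibly degenerate, that satisfies the
  comparisons with a margin.

  Such a configuration exists because \<open>\<real>\<^sup>d\<close> splits orthogonally into \<open>\<real>\<^bsup>d-2\<^esup>\<close> and a plane. A sphere of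
  radius \<open>R\<close> in dimension \<open>m \<ge> 2\<close> carries \<open>m + 2\<close> points whose pairwise inner products are nonpositive, so
  that their mutual squared distances are at least \<open>2R\<^sup>2\<close>: the vectors \<open>R e\<^sub>i\<close> together with two of
  their negatives. For \<open>m = d - 2\<close> this gives \<open>d\<close> points, and \<open>d \<ge> 4\<close> is what provides two
  different basis vectors to negate. In the plane take a triangle with circumradius about \<open>\<rho>\<close>, which can
  have squared sides about \<open>3\<rho>\<^sup>2\<close>. By orthogonality the squared distances between the two groups are about
  \<open>R\<^sup>2 + \<rho>\<^sup>2\<close>, and \<open>R\<^sup>2 + \<rho>\<^sup>2 < 3\<rho>\<^sup>2 < 2R\<^sup>2\<close> holds if \<open>\<rho>\<^sup>2 / R\<^sup>2\<close> lies strictly between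
  \<open>1/2\<close> and \<open>2/3\<close>. An almost regular triangle with small integer coordinates and
  \<open>R = 12\<close> keeps the arithmetic rational (lemma \<open>separated_configuration\<close>).

  For the perturbation (lemma \<open>generic_perturbation\<close>) the points are moved one at a time. Each
  way in which a new point can spoil genericity confines it to one of finitely many affine
  subspaces, bisectors and spheres; these are null sets and cannot cover a ball.
\<close>

section \<open>Perturbation to generic points\<close>

lemma negligible_affine_hull_few_points:
  fixes T :: "'a::euclidean_space set"
  assumes "finite T" and "card T \<le> DIM('a)"
  shows "negligible (affine hull T)"
proof -
  have "aff_dim (affine hull T) < int DIM('a)"
    using aff_dim_le_card[OF assms(1)] assms(2) by simp
  then obtain a b where "a \<noteq> 0" "affine hull T \<subseteq> {x. a \<bullet> x = b}"
    by (rule aff_lowdim_subset_hyperplane)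
  then show ?thesis
    using negligible_hyperplane negligible_subset by blast
qed

lemma negligible_bisector:
  fixes a b :: "'a::euclidean_space"
  assumes "a \<noteq> b"
  shows "negligible {x. dist x a = dist x b}"
proof -
  have "{x. dist x a = dist x b} = {x. (2 *\<^sub>R (b - a)) \<bullet> x = b \<bullet> b - a \<bullet> a}"
    by (auto simp: dist_norm norm_eq inner_diff_left inner_diff_right inner_commute algebra_simps)
  then show ?thesis
    using assms negligible_hyperplane[of "2 *\<^sub>R (b - a)" "b \<bullet> b - a \<bullet> a"] by simp
qed

lemma ball_avoids_finitely_many_negligible:
  fixes c :: "'a::euclidean_space"
  assumes "finite F" and "\<And>N. N \<in> F \<Longrightarrow> negligible N" and "e > 0"
  obtains x where "dist x c < e" and "\<And>N. N \<in> F \<Longrightarrow> x \<notin> N"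
proof -
  have "\<not> negligible (ball c e)"
    using assms(3) by (simp add: open_not_negligible)
  moreover have "negligible (\<Union>F)"
    using assms(1,2) by blast
  ultimately have "\<not> ball c e \<subseteq> \<Union>F"
    using negligible_subset by blast
  then obtain x where "x \<in> ball c e" "x \<notin> \<Union>F"
    by blast
  then show thesis
    using that[of x] by (auto simp: dist_commute)
qed

text \<open>
  Avoiding hyperplanes through \<open>d\<close> earlier points is not enough of an invariant for adding points one
  at a time: if those points lie in a smaller affine subspace, then every further point shares
  a hyperplane with them. Affine independence of all small subsets can be maintained instead, and it
  implies general position.
\<close>

lemma general_position_if_affine_independent:
  fixes P :: "'a::euclidean_space set"
  assumes "\<And>S. S \<subseteq> P \<Longrightarrow> card S \<le> DIM('a) + 1 \<Longrightarrow> \<not> affine_dependent S"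
  shows "general_position P"
  unfolding general_position_def
proof (intro allI impI notI)
  fix S assume S: "S \<subseteq> P \<and> finite S \<and> card S = DIM('a) + 1"
  assume "\<exists>H. hyperplane H \<and> S \<subseteq> H"
  then obtain a b where ab: "a \<noteq> 0" "S \<subseteq> {x. a \<bullet> x = b}"
    unfolding hyperplane_def by blast
  have "aff_dim S = int DIM('a)"
    using aff_dim_affine_independent[of S] assms[of S] S by simp
  moreover have "aff_dim S \<le> int DIM('a) - 1"
    using aff_dim_subset[OF ab(2)] aff_dim_hyperplane[OF ab(1), of b] by simp
  ultimately show False by simp
qed

lemma generic_perturbation:
  fixes q :: "nat \<Rightarrow> 'a::euclidean_space"
  assumes "e > 0"
  obtains p where "\<And>i. i < n \<Longrightarrow> dist (p i) (q i) < e" and "inj_on p {0..<n}"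
    and "general_position (p ` {0..<n})" and "distinct_distances n p"
proof -
  have "\<exists>p. (\<forall>i<n. dist (p i) (q i) < e) \<and> inj_on p {0..<n} \<and>
          (\<forall>S \<subseteq> p ` {0..<n}. card S \<le> DIM('a) + 1 \<longrightarrow> \<not> affine_dependent S) \<and>
          distinct_distances n p"
  proof (induction n)
    case 0
    then show ?case
      by (auto simp: distinct_distances_def index_pairs_def)
  next
    case (Suc n)
    then obtain p where close: "\<And>i. i < n \<Longrightarrow> dist (p i) (q i) < e"
      and inj: "inj_on p {0..<n}"
      and indep: "\<And>S. S \<subseteq> p ` {0..<n} \<Longrightarrow> card S \<le> DIM('a) + 1 \<Longrightarrow> \<not> affine_dependent S"
      and dd: "distinct_distances n p"
      by blast
    define hulls where "hulls = (\<lambda>T. affine hull T) ` {T \<in> Pow (p ` {0..<n}). card T \<le> DIM('a)}"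
    define bisectors where "bisectors =
      (\<lambda>(i, j). {x. dist x (p i) = dist x (p j)}) ` {(i, j) \<in> {0..<n} \<times> {0..<n}. i \<noteq> j}"
    define spheres where "spheres =
      (\<lambda>(i, k, l). sphere (p i) (dist (p k) (p l))) ` ({0..<n} \<times> {0..<n} \<times> {0..<n})"
    have "finite (hulls \<union> bisectors \<union> spheres)"
      unfolding hulls_def bisectors_def spheres_def
      by (auto intro!: finite_imageI intro: finite_subset[of _ "{0..<n} \<times> {0..<n}"])
    moreover have "negligible N" if "N \<in> hulls \<union> bisectors \<union> spheres" for N
      using that inj finite_subset[of _ "p ` {0..<n}"]
      unfolding hulls_def bisectors_def spheres_def
      by (auto simp: inj_on_eq_iff
          intro!: negligible_affine_hull_few_points negligible_bisector negligible_sphere)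
    ultimately obtain x where x: "dist x (q n) < e"
      and avoid: "\<And>N. N \<in> hulls \<union> bisectors \<union> spheres \<Longrightarrow> x \<notin> N"
      using \<open>e > 0\<close> ball_avoids_finitely_many_negligible by metis
    have x_hull: "x \<notin> affine hull T" if "T \<subseteq> p ` {0..<n}" "card T \<le> DIM('a)" for T
      using avoid[of "affine hull T"] that unfolding hulls_def by auto
    have x_bisector: "dist (p i) x \<noteq> dist (p j) x" if "i < n" "j < n" "i \<noteq> j" for i j
    proof -
      have "{x. dist x (p i) = dist x (p j)} \<in> bisectors"
        using that unfolding bisectors_def by force
      then show ?thesis
        using avoid by (auto simp: dist_commute)
    qed
    have x_sphere: "dist (p i) x \<noteq> dist (p k) (p l)" if "i < n" "k < n" "l < n" for i k l
    proof -
      have "sphere (p i) (dist (p k) (p l)) \<in> spheres"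
        using that unfolding spheres_def by force
      then show ?thesis
        using avoid[of "sphere (p i) (dist (p k) (p l))"] by auto
    qed
    \<comment> \<open>The degenerate spheres, of radius \<open>dist (p i) (p i) = 0\<close>, exclude the earlier points.\<close>
    have x_new: "x \<noteq> p i" if "i < n" for i
      using x_sphere[of i i i] that by auto
    define p' where "p' = p(n := x)"
    have p'_old: "p' i = p i" if "i < n" for i
      using that by (simp add: p'_def)
    have p'_new: "p' n = x"
      by (simp add: p'_def)
    have img: "p' ` {0..<Suc n} = insert x (p ` {0..<n})"
      by (auto simp: p'_def less_Suc_eq image_iff)
    have "dist (p' i) (q i) < e" if "i < Suc n" for i
      using that close x by (auto simp: p'_def less_Suc_eq)
    moreover have "inj_on p' {0..<Suc n}"
      using inj x_new by (fastforce simp: p'_def inj_on_def less_Suc_eq)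
    moreover have "\<not> affine_dependent S"
      if S: "S \<subseteq> p' ` {0..<Suc n}" "card S \<le> DIM('a) + 1" for S
    proof (cases "x \<in> S")
      case True
      have T: "S - {x} \<subseteq> p ` {0..<n}"
        using S(1) img by auto
      have fin: "finite S"
        using S(1) finite_subset by blast
      then have card: "card (S - {x}) \<le> DIM('a)"
        using S(2) True by simp
      have "\<not> affine_dependent (insert x (S - {x}))"
        using indep[OF T] card x_hull[OF T card] by (intro affine_independent_insert) auto
      then show ?thesis
        using True by (simp add: insert_absorb)
    next
      case False
      then have "S \<subseteq> p ` {0..<n}"
        using S(1) img by auto
      then show ?thesis
        using S(2) by (rule indep)
    qed
    moreover have "distinct_distances (Suc n) p'"
      unfolding distinct_distances_def
    proof (rule inj_onI, clarify)
      fix i j k l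
      assume ij: "(i, j) \<in> index_pairs (Suc n)" and kl: "(k, l) \<in> index_pairs (Suc n)"
        and eq: "dist (p' i) (p' j) = dist (p' k) (p' l)"
      have lt: "i < j" "j \<le> n" "k < l" "l \<le> n"
        using ij kl by (auto simp: index_pairs_def)
      consider "j < n" "l < n" | "j = n" "l < n" | "j < n" "l = n" | "j = n" "l = n"
        using lt by linarith
      then show "i = k \<and> j = l"
      proof cases
        case 1
        then have "(i, j) \<in> index_pairs n" "(k, l) \<in> index_pairs n"
          using lt by (auto simp: index_pairs_def)
        then show ?thesis
          using inj_onD[OF dd[unfolded distinct_distances_def], of "(i, j)" "(k, l)"] eq 1 lt
          by (simp add: p'_old)
      next
        case 2
        then show ?thesis
          using eq lt x_sphere[of i k l] by (simp add: p'_old p'_new)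
      next
        case 3
        then show ?thesis
          using eq lt x_sphere[of k i j] by (simp add: p'_old p'_new)
      next
        case 4
        then show ?thesis
          using eq lt x_bisector[of i k] by (auto simp: p'_old p'_new)
      qed
    qed
    ultimately show ?case by blast
  qed
  then show thesis
    using that general_position_if_affine_independent by blast
qed

section \<open>A configuration with separated distances\<close>

lemma dist_square_inner:
  fixes x y :: "'a::real_inner"
  shows "(dist x y)\<^sup>2 = x \<bullet> x - 2 * (x \<bullet> y) + y \<bullet> y"
  by (simp add: dist_norm power2_norm_eq_inner inner_diff_left inner_diff_right inner_commute)

text \<open>
  With \<open>R = 12\<close> and the triangle \<open>(0, 9)\<close>, \<open>(8, -4)\<close>, \<open>(-8, -4)\<close> the squared distances are \<open>224\<close> or
  \<open>225\<close> between the groups, \<open>233\<close> or \<open>256\<close> in the triangle, and at least \<open>288\<close> in the first group.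
  The bounds below are rational and keep distances from different ranges at least \<open>1/5\<close> apart.
\<close>

lemma separated_configuration:
  assumes "DIM('a) = d" and "d \<ge> 4"
  obtains q :: "nat \<Rightarrow> 'a::euclidean_space" where
    "\<And>i j. i < d \<Longrightarrow> d \<le> j \<Longrightarrow> j < d + 3 \<Longrightarrow> dist (q i) (q j) \<le> 15"
    "\<And>i j. d \<le> i \<Longrightarrow> i < j \<Longrightarrow> j < d + 3 \<Longrightarrow>
      76 / 5 \<le> dist (q i) (q j) \<and> dist (q i) (q j) \<le> 16"
    "\<And>i j. i < j \<Longrightarrow> j < d \<Longrightarrow> 84 / 5 \<le> dist (q i) (q j)"
proof -
  obtain b :: "nat \<Rightarrow> 'a" where b: "bij_betw b {0..<d} Basis"
    using ex_bij_betw_nat_finite[OF finite_Basis] assms(1) by metis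
  have orth: "b i \<bullet> b j = (if i = j then 1 else 0)" if "i < d" "j < d" for i j
    using that bij_betwE[OF b] bij_betw_imp_inj_on[OF b]
    by (auto simp: inner_Basis inj_on_eq_iff)
  define u where "u = b (d - 2)"
  define v where "v = b (d - 1)"
  define q where "q i =
    (if i < d - 2 then 12 *\<^sub>R b i
     else if i = d - 2 then (- 12) *\<^sub>R b 0
     else if i = d - 1 then (- 12) *\<^sub>R b 1
     else if i = d then 9 *\<^sub>R v
     else if i = d + 1 then 8 *\<^sub>R u - 4 *\<^sub>R v
     else - 8 *\<^sub>R u - 4 *\<^sub>R v)" for i
  have uv: "u \<bullet> u = 1" "v \<bullet> v = 1" "u \<bullet> v = 0" "v \<bullet> u = 0"
    using assms(2) by (auto simp: u_def v_def orth)
  have q_last: "q d = 9 *\<^sub>R v" "q (Suc d) = 8 *\<^sub>R u - 4 *\<^sub>R v" "q (Suc (Suc d)) = - 8 *\<^sub>R u - 4 *\<^sub>R v"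
    using assms(2) by (auto simp: q_def)
  have perp: "q i \<bullet> u = 0" "q i \<bullet> v = 0" if "i < d" for i
    using that assms(2) by (auto simp: q_def u_def v_def orth)
  have first_norm: "q i \<bullet> q i = 144" if "i < d" for i
    using that assms(2) by (auto simp: q_def orth)
  have first_obtuse: "q i \<bullet> q j \<le> 0" if "i < j" "j < d" for i j
    using that assms(2) by (auto simp: q_def orth)
  have last: "j = d \<or> j = d + 1 \<or> j = d + 2" if "d \<le> j" "j < d + 3" for j
    using that by linarith
  have cross: "dist (q i) (q j) \<le> 15" if "i < d" "d \<le> j" "j < d + 3" for i j
  proof -
    have "(dist (q i) (q j))\<^sup>2 \<le> 15\<^sup>2"
      using last[OF that(2,3)] perp[OF that(1)] uv first_norm[OF that(1)]
      by (auto simp: dist_square_inner q_last inner_diff_left inner_diff_right)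
    then show ?thesis
      by (rule power2_le_imp_le) simp
  qed
  have triangle: "76 / 5 \<le> dist (q i) (q j) \<and> dist (q i) (q j) \<le> 16"
    if "d \<le> i" "i < j" "j < d + 3" for i j
  proof -
    have "i = d \<and> j = d + 1 \<or> i = d \<and> j = d + 2 \<or> i = d + 1 \<and> j = d + 2"
      using that by linarith
    then have "(dist (q i) (q j))\<^sup>2 \<in> {233, 256}"
      using uv by (auto simp: dist_square_inner q_last inner_diff_left inner_diff_right)
    then have "(76 / 5)\<^sup>2 \<le> (dist (q i) (q j))\<^sup>2" "(dist (q i) (q j))\<^sup>2 \<le> 16\<^sup>2"
      by (auto simp: power2_eq_square)
    then show ?thesis
      by (auto intro: power2_le_imp_le)
  qed
  have first: "84 / 5 \<le> dist (q i) (q j)" if "i < j" "j < d" for i j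
  proof -
    have "(84 / 5)\<^sup>2 \<le> (dist (q i) (q j))\<^sup>2"
      using first_obtuse[OF that] first_norm[of i] first_norm[of j] that
      by (simp add: dist_square_inner power_divide)
    then show ?thesis
      by (rule power2_le_imp_le) simp
  qed
  show thesis
    using that[of q] cross triangle first by blast
qed

section \<open>The point set\<close>

theorem proposition6:
  fixes d :: nat
  assumes "d = CARD('d::finite)" and "d \<ge> 4"
  shows "\<exists>(P :: (real ^ 'd) set) (p :: nat \<Rightarrow> real ^ 'd).
           P = p ` {0..<d + 3} \<and> card P = d + 3 \<and>
           general_position P \<and>
           distinct_distances (d + 3) p \<and>
           (\<forall>(i, j) \<in> index_pairs d. \<forall>(k, l) \<in> index_pairs (d + 3) - index_pairs d.
              ((k, l), (i, j)) \<in> distance_order (d + 3) p) \<and>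
           (\<forall>(i, j) \<in> {0..<d} \<times> {d, d + 1, d + 2}.
              \<forall>(k, l) \<in> index_pairs (d + 3) - {0..<d} \<times> {d, d + 1, d + 2}.
              ((i, j), (k, l)) \<in> distance_order (d + 3) p)"
proof -
  have "DIM(real ^ 'd) = d"
    using assms(1) by simp
  then obtain q :: "nat \<Rightarrow> real ^ 'd" where
    q_cross: "\<And>i j. i < d \<Longrightarrow> d \<le> j \<Longrightarrow> j < d + 3 \<Longrightarrow> dist (q i) (q j) \<le> 15" and
    q_triangle: "\<And>i j. d \<le> i \<Longrightarrow> i < j \<Longrightarrow> j < d + 3 \<Longrightarrow>
      76 / 5 \<le> dist (q i) (q j) \<and> dist (q i) (q j) \<le> 16" and
    q_first: "\<And>i j. i < j \<Longrightarrow> j < d \<Longrightarrow> 84 / 5 \<le> dist (q i) (q j)"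
    using separated_configuration[OF _ assms(2)] by metis
  \<comment> \<open>Moving each point by less than \<open>1/20\<close> changes each distance by less than \<open>1/10\<close>,
    which is half the gap between the ranges.\<close>
  obtain p where close: "\<And>i. i < d + 3 \<Longrightarrow> dist (p i) (q i) < 1 / 20"
    and inj: "inj_on p {0..<d + 3}" and gp: "general_position (p ` {0..<d + 3})"
    and dd: "distinct_distances (d + 3) p"
    using generic_perturbation[of "1 / 20" "d + 3" q] by auto
  have near: "dist (p i) (p j) < dist (q i) (q j) + 1 / 10 \<and>
      dist (q i) (q j) < dist (p i) (p j) + 1 / 10" if "i < d + 3" "j < d + 3" for i j
    using close[OF that(1)] close[OF that(2)]
      dist_triangle[of "p i" "p j" "q i"] dist_triangle[of "q i" "p j" "q j"]
      dist_triangle[of "q i" "q j" "p i"] dist_triangle[of "p i" "q j" "p j"]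
      dist_commute[of "q i" "p i"] dist_commute[of "q j" "p j"]
    by linarith
  have p_cross: "dist (p i) (p j) < 151 / 10" if "i < d" "d \<le> j" "j < d + 3" for i j
    using q_cross[OF that] near[of i j] that by simp
  have p_triangle: "151 / 10 < dist (p i) (p j) \<and> dist (p i) (p j) < 161 / 10"
    if "d \<le> i" "i < j" "j < d + 3" for i j
    using q_triangle[OF that] near[of i j] that by simp
  have p_first: "167 / 10 < dist (p i) (p j)" if "i < j" "j < d" for i j
    using q_first[OF that] near[of i j] that by simp
  have "((k, l), (i, j)) \<in> distance_order (d + 3) p"
    if ij: "(i, j) \<in> index_pairs d" and kl: "(k, l) \<in> index_pairs (d + 3) - index_pairs d"
    for i j k l
  proof -
    have "i < j" "j < d" "k < l" "l < d + 3" "d \<le> l"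
      using ij kl by (auto simp: index_pairs_def)
    moreover from this have "dist (p k) (p l) < dist (p i) (p j)"
      using p_first[of i j] p_cross[of k l] p_triangle[of k l] by linarith
    ultimately show ?thesis
      by (auto simp: distance_order_def index_pairs_def)
  qed
  moreover have "((i, j), (k, l)) \<in> distance_order (d + 3) p"
    if ij: "(i, j) \<in> {0..<d} \<times> {d, d + 1, d + 2}"
      and kl: "(k, l) \<in> index_pairs (d + 3) - {0..<d} \<times> {d, d + 1, d + 2}"
    for i j k l
  proof -
    have "i < d" "d \<le> j" "j < d + 3" "k < l" "l < d + 3" "l < d \<or> d \<le> k"
      using ij kl by (auto simp: index_pairs_def)
    moreover from this have "dist (p i) (p j) < dist (p k) (p l)"
      using p_cross[of i j] p_first[of k l] p_triangle[of k l] by linarith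
    ultimately show ?thesis
      by (auto simp: distance_order_def index_pairs_def)
  qed
  moreover have "card (p ` {0..<d + 3}) = d + 3"
    using card_image[OF inj] by simp
  ultimately show ?thesis
    using gp dd by (intro exI[of _ "p ` {0..<d + 3}"] exI[of _ p]) fast
qed

end
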